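(* Let $G$ be a connected graph of order $m\geq 2$ and $H$ be a connected graph of order $n$. If $p(G)=\frac{n_o(G)}{2}$, then $p(G\Box H)\leq \frac{mn}{2}$.
   Context: All graphs are finite, simple and undirected. A path decomposition of a graph $G$ is a collection of edge-disjoint paths covering all edges of $G$; $p(G)$ denotes the minimum number of paths in a path decomposition of $G$. $n_o(G)$ denotes the number of vertices of odd degree in $G$. The Cartesian product $G\Box H$ has vertex set $V(G)\times V(H)$, with $(u_1,v_1)(u_2,v_2)$ an edge iff either $u_1u_2\in E(G)$ and $v_1=v_2$, or $v_1v_2\in E(H)$ and $u_1=u_2$. *)

theory Defs
  imports Complex_Main "Graph_Theory.Graph_Theory"
begin

text \<open>
  A finite simple undirected graph is a \<^locale>\<open>pair_graph\<close>: a finite digraph without loops and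
  parallel arcs whose arc relation is symmetric. An undirected edge is thus represented by two
  opposite arcs, and the edge itself is recovered as a two-element set of vertices.
\<close>

definition edges_of :: "'a pair_pre_digraph \<Rightarrow> 'a set set" where
  "edges_of G = {{u, v} | u v. (u, v) \<in> parcs G}"

definition path_edges :: "'a vwalk \<Rightarrow> 'a set set" where
  "path_edges p = {{u, v} | u v. (u, v) \<in> set (vwalk_arcs p)}"

text \<open>
  Paths are given by their vertex sequences. A nontrivial path and its reversal are different
  sequences with the same edges, so edge-disjointness prevents both from occurring in \<open>P\<close>.
  Single-vertex paths are allowed in \<open>P\<close>; they cover no edge and do not affect the minimum.
\<close>

definition path_decomposition :: "'a pair_pre_digraph \<Rightarrow> 'a vwalk set \<Rightarrow> bool" where
  "path_decomposition G P \<longleftrightarrow>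
     finite P \<and>
     (\<forall>p\<in>P. vpath p (with_proj G)) \<and>
     (\<forall>p\<in>P. \<forall>q\<in>P. p \<noteq> q \<longrightarrow> path_edges p \<inter> path_edges q = {}) \<and>
     (\<Union>p\<in>P. path_edges p) = edges_of G"

definition path_number :: "'a pair_pre_digraph \<Rightarrow> nat" where
  "path_number G = (LEAST k. \<exists>P. path_decomposition G P \<and> card P = k)"

text \<open>
  Since every edge at \<open>v\<close> contributes exactly one arc leaving \<open>v\<close>, the degree of \<open>v\<close> is its
  out-degree.
\<close>

definition n_odd :: "'a pair_pre_digraph \<Rightarrow> nat" where
  "n_odd G = card {v \<in> pverts G. odd (out_degree (with_proj G) v)}"

definition cart_prod ::
    "'a pair_pre_digraph \<Rightarrow> 'b pair_pre_digraph \<Rightarrow> ('a \<times> 'b) pair_pre_digraph" where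
  "cart_prod G H =
     \<lparr> pverts = pverts G \<times> pverts H,
       parcs = {((u1, v1), (u2, v2)) | u1 v1 u2 v2.
         (u1, v1) \<in> pverts G \<times> pverts H \<and> (u2, v2) \<in> pverts G \<times> pverts H \<and>
         ((u1, u2) \<in> parcs G \<and> v1 = v2 \<or> (v1, v2) \<in> parcs H \<and> u1 = u2)} \<rparr>"

lemma pair_graph_cart_prod:
  assumes "pair_graph G" and "pair_graph H"
  shows "pair_graph (cart_prod G H)"
proof -
  interpret G: pair_graph G by fact
  interpret H: pair_graph H by fact
  let ?V = "pverts G \<times> pverts H"
  have fin: "finite ?V" by simp
  have sub: "parcs (cart_prod G H) \<subseteq> ?V \<times> ?V"
    by (auto simp: cart_prod_def)
  have symG: "(v, u) \<in> parcs G" if "(u, v) \<in> parcs G" for u v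
    using G.sym_arcs that by (auto simp: symmetric_def sym_def)
  have symH: "(v, u) \<in> parcs H" if "(u, v) \<in> parcs H" for u v
    using H.sym_arcs that by (auto simp: symmetric_def sym_def)
  show ?thesis
  proof unfold_locales
    show "finite (parcs (cart_prod G H))"
      using sub fin by (meson finite_SigmaI finite_subset)
    show "symmetric (with_proj (cart_prod G H))"
      unfolding symmetric_def sym_def by (auto simp: cart_prod_def symG symH)
  qed (auto simp: cart_prod_def dest: G.pair_no_loops H.pair_no_loops)
qed

lemma path_decomposition_exists:
  assumes "pair_graph G"
  shows "\<exists>P. path_decomposition G P"
proof -
  interpret G: pair_graph G by fact
  define f where "f = (\<lambda>e. SOME p. vpath p (with_proj G) \<and> path_edges p = {e})"
  have f: "vpath (f e) (with_proj G) \<and> path_edges (f e) = {e}" if "e \<in> edges_of G" for e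
  proof -
    obtain u v where uv: "e = {u, v}" "(u, v) \<in> parcs G"
      using \<open>e \<in> edges_of G\<close> by (auto simp: edges_of_def)
    have "vpath [u, v] (with_proj G) \<and> path_edges [u, v] = {e}"
      using uv G.pair_no_loops[OF uv(2)]
      by (auto simp: vpath_def vwalk_def path_edges_def dest: G.wellformed')
    then show ?thesis unfolding f_def by (rule someI)
  qed
  have "edges_of G = (\<lambda>(u, v). {u, v}) ` parcs G"
    by (auto simp: edges_of_def)
  then have "finite (edges_of G)" using G.pair_finite_arcs by simp
  moreover have "(\<Union>p\<in>f ` edges_of G. path_edges p) = edges_of G"
    using f by auto
  moreover have "path_edges p \<inter> path_edges q = {}"
    if "p \<in> f ` edges_of G" "q \<in> f ` edges_of G" "p \<noteq> q" for p q
    using that f by auto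
  ultimately have "path_decomposition G (f ` edges_of G)"
    unfolding path_decomposition_def using f by auto
  then show ?thesis ..
qed

end

theory Submission
  imports Defs
begin

text \<open>
  By a rotation argument of Lovasz, every finite graph decomposes into paths so that exactly one
  path end lies at each vertex of odd degree and two lie at each vertex of even degree (a trivial
  path counts twice). The paths can then be directed so that every vertex is the start of at most
  one and the end of at most one of them. Applied to \<open>H\<close> this gives a set \<open>S\<close> of start vertices,
  \<open>2 * card S \<ge> n\<close>, and paths \<open>Q v\<close> for \<open>v \<in> S\<close> with distinct final vertices.

  If \<open>p(G) = n_o(G) / 2\<close>, an optimal decomposition of \<open>G\<close> has exactly one path end at each odd
  vertex and none at an even vertex. Assign every vertex \<open>u\<close> of \<open>G\<close> to a path through \<open>u\<close>, and
  to the path ending at \<open>u\<close> if there is one; every path is then assigned both of its ends. Now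
  let the \<open>n\<close> copies of a path \<open>p\<close> run in parallel through the product. At the first assigned
  vertex, they start with the copies of the \<open>Q v\<close> (or trivially); at each later one, the strand in
  layer \<open>v \<in> S\<close> is diverted along \<open>Q v\<close> and continues from the end of \<open>Q v\<close>, the strands in the
  other \<open>n - card S\<close> layers end, and as many new ones begin, except at the last one.
  With \<open>a\<close> assigned vertices on \<open>p\<close>,
  at most \<open>(a - 2) * (n - card S) + n \<le> a * n / 2\<close> paths arise, and the numbers \<open>a\<close> add up to \<open>m\<close>.
\<close>

section \<open>Edge multisets of paths\<close>

fun edge_mset :: "'a list \<Rightarrow> 'a set multiset" where
  "edge_mset (x # y # p) = add_mset {x, y} (edge_mset (y # p))"
| "edge_mset p = {#}"

lemma edge_mset_append:
  assumes "p \<noteq> []" "q \<noteq> []"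
  shows "edge_mset (p @ q) = edge_mset p + edge_mset q + {#{last p, hd q}#}"
  using assms
proof (induction p rule: edge_mset.induct)
  case ("2_2" v)
  then show ?case by (cases q) auto
qed auto

lemma edge_mset_rev [simp]: "edge_mset (rev p) = edge_mset p"
proof (induction p rule: edge_mset.induct)
  case (1 x y p)
  then show ?case
    using edge_mset_append[of "rev p @ [y]" "[x]"] by (simp add: insert_commute)
qed auto

lemma edge_mset_map: "edge_mset (map f p) = image_mset ((`) f) (edge_mset p)"
  by (induction p rule: edge_mset.induct) auto

lemma edge_mset_subset: "e \<in># edge_mset p \<Longrightarrow> e \<subseteq> set p"
  by (induction p rule: edge_mset.induct) auto

lemma set_edge_mset: "set_mset (edge_mset p) = path_edges p"
proof (induction p rule: edge_mset.induct)
  case (1 x y p)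
  have "path_edges (x # y # p) = insert {x, y} (path_edges (y # p))"
    by (auto simp: path_edges_def)
  with 1 show ?case by simp
qed (auto simp: path_edges_def)

text \<open>Each edge at the first vertex of a tail-distinct list is new, because that vertex never
  recurs; hence no edge has multiplicity above one.\<close>

lemma edge_mset_distinct: "distinct p \<Longrightarrow> edge_mset p = mset_set (path_edges p)"
proof -
  have "count (edge_mset p) e \<le> 1" if "distinct p" for e
    using that
  proof (induction p rule: edge_mset.induct)
    case (1 x y p)
    then have "{x, y} \<notin># edge_mset (y # p)" using edge_mset_subset by fastforce
    with 1 show ?case by (auto simp: not_in_iff)
  qed auto
  moreover assume "distinct p"
  moreover have "finite (path_edges p)" by (metis finite_set_mset set_edge_mset)
  ultimately show ?thesis
    by (intro multiset_eqI)
      (metis One_nat_def count_eq_zero_iff count_mset_set(1,3) le_Suc_eq le_zero_eq set_edge_mset)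
qed

text \<open>A trivial path has two ends at its only vertex. With this convention every path has two
  ends in all, and the parity of the degree equals the parity of the number of ends at each
  vertex.\<close>

definition path_ends :: "'a list \<Rightarrow> 'a \<Rightarrow> nat" where
  "path_ends p v = of_bool (hd p = v) + of_bool (last p = v)"

abbreviation total_ends :: "'a list multiset \<Rightarrow> 'a \<Rightarrow> nat" where
  "total_ends M v \<equiv> (\<Sum>p\<in>#M. path_ends p v)"

text \<open>
  Edges are counted with multiplicity, so \<open>decomposes M (mset_set E)\<close> entails edge-disjointness.
\<close>

definition decomposes :: "'a list multiset \<Rightarrow> 'a set multiset \<Rightarrow> bool" where
  "decomposes M X \<longleftrightarrow> (\<forall>p\<in>#M. p \<noteq> [] \<and> distinct p) \<and> (\<Sum>p\<in>#M. edge_mset p) = X"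

lemma path_ends_rev [simp]: "p \<noteq> [] \<Longrightarrow> path_ends (rev p) v = path_ends p v"
  by (simp add: path_ends_def hd_rev last_rev)

section \<open>Rotation of paths at a vertex\<close>

text \<open>Undirected paths may be read from either end, so a rotation can always take the relevant
  end to be the first vertex.\<close>

definition path_upto_rev :: "'a list multiset \<Rightarrow> 'a list \<Rightarrow> bool" where
  "path_upto_rev M q \<longleftrightarrow> q \<in># M \<or> rev q \<in># M"

text \<open>Here \<open>w\<close> is an end of a path through \<open>x\<close>, and \<open>z\<close>
  is the neighbour of \<open>x\<close> whose edge is released when the part from \<open>w\<close> to
  \<open>z\<close> is reversed.\<close>

definition has_arm :: "'a list multiset \<Rightarrow> 'a \<Rightarrow> 'a \<Rightarrow> 'a \<Rightarrow> bool" where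
  "has_arm M x w z \<longleftrightarrow> (\<exists>a b. a \<noteq> [] \<and> hd a = w \<and> last a = z \<and> path_upto_rev M (a @ x # b))"

text \<open>This is the situation in which the rotations stop: \<open>x\<close> can be put in front
  of \<open>w\<close> and the result is still a path.\<close>

definition has_free_end :: "'a list multiset \<Rightarrow> 'a \<Rightarrow> 'a \<Rightarrow> bool" where
  "has_free_end M x w \<longleftrightarrow> (\<exists>q. q \<noteq> [] \<and> hd q = w \<and> x \<notin> set q \<and> path_upto_rev M q)"

lemma path_upto_revE:
  assumes "path_upto_rev M q"
  obtains p M0 where "M = add_mset p M0" "p = q \<or> p = rev q"
  using assms unfolding path_upto_rev_def by (metis mset_add)

lemma append_Cons_eq_iff_distinct:
  assumes "distinct (a @ x # b)" "a @ x # b = a' @ x # b'"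
  shows "a = a' \<and> b = b'"
  using assms by (metis append_Cons_eq_iff distinct.simps(2) distinct_append not_distinct_conv_prefix)

text \<open>
  If a path \<open>a @ x # b\<close> starts at \<open>y\<close>, reversing \<open>a\<close> inserts the missing edge \<open>xy\<close> and drops the edge
  from \<open>x\<close> to \<open>last a\<close>, which becomes the missing one. \<open>U\<close> holds the neighbours of \<open>x\<close> not yet
  treated in this way; as each edge at \<open>x\<close> lies in one path only, the last hypothesis survives
  the step with \<open>U - {y}\<close>.
\<close>

lemma rotate_at:
  assumes "finite U" "y \<in> U" "x \<notin> U" "decomposes M X" "add_mset {x, y} X = mset_set E"
    and "\<And>w. w \<in> U \<Longrightarrow> has_free_end M x w \<or> (\<exists>z\<in>U - {y}. has_arm M x w z)"
  shows "\<exists>M'. decomposes M' (mset_set E) \<and>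
    (\<forall>v. total_ends M' v + of_bool (v = y) = total_ends M v + of_bool (v = x))"
  using assms
proof (induction "card U" arbitrary: U y M X)
  case 0
  then show ?case by auto
next
  case (Suc n)
  have X: "X = (\<Sum>p\<in>#M. edge_mset p)" and M: "\<And>p. p \<in># M \<Longrightarrow> p \<noteq> [] \<and> distinct p"
    using Suc.prems(4) by (auto simp: decomposes_def)
  have "x \<noteq> y" using Suc.prems by auto
  consider "has_free_end M x y" | z where "z \<in> U - {y}" "has_arm M x y z"
    using Suc.prems by blast
  then show ?case
  proof cases
    case 1
    then obtain q p M0 where q: "q \<noteq> []" "hd q = y" "x \<notin> set q" 
      and p: "M = add_mset p M0" "p = q \<or> p = rev q"
      unfolding has_free_end_def by (metis path_upto_revE)
    \<comment> \<open>Prepending \<open>x\<close> absorbs the missing edge and moves one path end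
      from \<open>y\<close> to \<open>x\<close>.\<close>
    let ?M' = "add_mset (x # q) M0"
    have dq: "distinct q" "edge_mset p = edge_mset q" "\<And>v. path_ends p v = path_ends q v"
      using p M[of p] q by auto
    have "edge_mset (x # q) = add_mset {x, y} (edge_mset q)"
      using q by (cases q) auto
    then have "decomposes ?M' (mset_set E)"
      using Suc.prems(5) p dq q M X by (auto simp: decomposes_def)
    moreover have "total_ends ?M' v + of_bool (v = y) = total_ends M v + of_bool (v = x)" for v
      using q p(1) dq(3)[of v] by (auto simp: path_ends_def)
    ultimately show ?thesis by blast
  next
    case 2
    then obtain a b p M0 where a: "a \<noteq> []" "hd a = y" "last a = z"
      and p: "M = add_mset p M0" "p = a @ x # b \<or> p = rev (a @ x # b)"
      unfolding has_arm_def by (metis path_upto_revE)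
    define q where "q = a @ x # b"
    define q' where "q' = rev a @ x # b"
    let ?M' = "add_mset q' M0"
    have dq: "distinct q" "edge_mset p = edge_mset q" "\<And>v. path_ends p v = path_ends q v"
      using p M[of p] a by (auto simp: q_def simp del: rev_append)
    have eq: "edge_mset q = edge_mset a + edge_mset (x # b) + {#{x, z}#}"
      "edge_mset q' = edge_mset a + edge_mset (x # b) + {#{x, y}#}"
      using a by (auto simp: q_def q'_def edge_mset_append last_rev insert_commute)
    have "y \<noteq> z" using 2 by auto
    define X' where "X' = add_mset {x, y} X - {#{x, z}#}"
    have zX: "{x, z} \<in># X" using p(1) dq(2) eq X by simp
    have dec': "decomposes ?M' X'"
      using M p(1) dq eq X by (auto simp: decomposes_def X'_def q_def q'_def)
    have E': "add_mset {x, z} X' = mset_set E"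
      unfolding X'_def Suc.prems(5)[symmetric] using zX by (intro insert_DiffM) simp
    \<comment> \<open>Together with the missing edge, \<open>X\<close> is a set of edges, so the
      edge \<open>xz\<close> of \<open>p\<close> occurs in no other path and no arm outside
      \<open>p\<close> can reach \<open>x\<close> from \<open>z\<close>.\<close>
    have zuniq: "count X {x, z} \<le> 1"
    proof -
      have "count X {x, z} \<le> count (mset_set E) {x, z}" unfolding Suc.prems(5)[symmetric] by simp
      also have "\<dots> \<le> 1" by (simp add: count_mset_set')
      finally show ?thesis .
    qed
    have zM0: "{x, z} \<notin># (\<Sum>p\<in>#M0. edge_mset p)"
    proof
      assume "{x, z} \<in># (\<Sum>p\<in>#M0. edge_mset p)"
      then have "count X {x, z} \<ge> 2"
        using X p(1) dq(2) eq(1) by (simp add: Suc_le_eq)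
      with zuniq show False by simp
    qed
    have arms: "has_free_end ?M' x w \<or> (\<exists>z'\<in>U - {y} - {z}. has_arm ?M' x w z')"
      if w: "w \<in> U - {y}" for w
    proof -
      consider "has_free_end M x w" | z' where "z' \<in> U - {y}" "has_arm M x w z'"
        using Suc.prems(6)[of w] w by auto
      then show ?thesis
      proof cases
        case 1
        then obtain r where r: "r \<noteq> []" "hd r = w" "x \<notin> set r" "path_upto_rev M r"
          unfolding has_free_end_def by blast
        have "x \<in> set p" using p(2) by auto
        with r(3) have "r \<noteq> p" "rev r \<noteq> p" by (metis set_rev)+
        with r(4) have "path_upto_rev ?M' r" by (auto simp: path_upto_rev_def p(1))
        with r show ?thesis unfolding has_free_end_def by blast
      next
        case arm: 2
        then obtain a' b' where a': "a' \<noteq> []" "hd a' = w" "last a' = z'"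
          "path_upto_rev M (a' @ x # b')" unfolding has_arm_def by blast
        let ?r = "a' @ x # b'"
        have er: "{x, z'} \<in># edge_mset ?r" using a' by (simp add: edge_mset_append insert_commute)
        consider "path_upto_rev M0 ?r" | "?r = q" | "?r = rev q"
          using a'(4) p by (auto simp: path_upto_rev_def q_def simp del: rev_append)
            (metis rev_rev_ident)+
        then show ?thesis
        proof cases
          case 1
          then have "{x, z'} \<in># (\<Sum>p\<in>#M0. edge_mset p)"
            using er edge_mset_rev[of ?r] unfolding path_upto_rev_def
        by (metis in_Union_mset_iff image_eqI set_image_mset)
          then have "z' \<noteq> z" using zM0 by auto
          moreover have "has_arm ?M' x w z'"
            using 1 a' unfolding has_arm_def path_upto_rev_def by fastforce
          ultimately show ?thesis using arm by blast
        next
          case 2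
          \<comment> \<open>Read in the same direction as \<open>q\<close>, the arm starts at
            \<open>y\<close>, which was removed from \<open>U\<close>.\<close>
          then have "a' = a" using append_Cons_eq_iff_distinct dq(1) unfolding q_def by metis
          then show ?thesis using a a' w by auto
        next
          case 3
          \<comment> \<open>Read from its far end, \<open>q\<close> reaches \<open>x\<close> through
            \<open>b\<close>. The rotation leaves \<open>b\<close> in place, and the neighbour
            \<open>z'\<close> lies in \<open>b\<close>, whereas \<open>z\<close> lies in
            \<open>a\<close>.\<close>
          then have *: "rev b @ x # rev a = a' @ x # b'" "distinct (rev b @ x # rev a)"
            using dq by (auto simp: q_def)
          have ab: "a' = rev b" "b' = rev a" using append_Cons_eq_iff_distinct[OF *(2,1)] by auto
          then have "z' \<in> set b" using a' by (metis last_in_set set_rev)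
          moreover have "z \<in> set a" using a by auto
          ultimately have "z' \<noteq> z" using dq(1) by (auto simp: q_def)
          moreover have "rev q' = a' @ x # rev b'" by (simp add: q'_def ab)
          then have "path_upto_rev ?M' (a' @ x # rev b')"
            unfolding path_upto_rev_def by (metis rev_rev_ident union_single_eq_member)
          then have "has_arm ?M' x w z'" using a' unfolding has_arm_def by blast
          ultimately show ?thesis using arm by blast
        qed
      qed
    qed
    have "n = card (U - {y})" using Suc.hyps(2) Suc.prems(1,2) by simp
    from Suc.hyps(1)[OF this _ _ _ dec' E' arms]
    obtain M' where M': "decomposes M' (mset_set E)" 
      "\<And>v. total_ends M' v + of_bool (v = z) = total_ends ?M' v + of_bool (v = x)"
      using Suc.prems(1,3) 2 by auto
    \<comment> \<open>Reversing \<open>a\<close> moves an end from \<open>y\<close> to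
      \<open>z\<close>; the remaining rotations move one from \<open>z\<close> to
      \<open>x\<close>.\<close>
    have "total_ends M' v + of_bool (v = y) = total_ends M v + of_bool (v = x)" for v
    proof -
      have "path_ends q v + of_bool (v = z) = path_ends q' v + of_bool (v = y)"
        using a by (auto simp: path_ends_def q_def q'_def hd_rev)
      then show ?thesis using M'(2)[of v] p(1) dq(3)[of v] by simp
    qed
    with M' show ?thesis by blast
  qed
qed

section \<open>Decompositions with prescribed path ends\<close>

text \<open>The base of the induction on edges: \<open>d v div 2\<close> copies of
  \<open>[v]\<close> supply exactly the ends prescribed at \<open>v\<close>.\<close>

lemma trivial_paths:
  fixes d :: "'a \<Rightarrow> nat"
  assumes "finite V" "\<And>v. even (d v)"
  shows "\<exists>M. decomposes M {#} \<and> (\<forall>v. total_ends M v = (if v \<in> V then d v else 0))"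
  using assms(1)
proof (induction V)
  case empty
  show ?case by (rule exI[of _ "{#}"]) (simp add: decomposes_def)
next
  case (insert x V)
  then obtain M where M: "decomposes M {#}" "\<And>v. total_ends M v = (if v \<in> V then d v else 0)"
    by blast
  let ?M' = "M + replicate_mset (d x div 2) [x]"
  have "decomposes ?M' {#}" using M(1) by (auto simp: decomposes_def)
  moreover have "total_ends ?M' v = (if v \<in> insert x V then d v else 0)" for v
    using M(2)[of v] insert.hyps assms(2)[of x] by (auto simp: path_ends_def)
  ultimately show ?case by blast
qed

lemma exists_path_upto_rev:
  assumes "decomposes M X" "total_ends M w > 0"
  shows "\<exists>q. q \<noteq> [] \<and> distinct q \<and> hd q = w \<and> path_upto_rev M q"
proof -
  have "\<exists>p\<in>#M. path_ends p w \<noteq> 0"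
  proof (rule ccontr)
    assume "\<not> ?thesis"
    then have "image_mset (\<lambda>p. path_ends p w) M = image_mset (\<lambda>_. 0) M"
      by (intro image_mset_cong) auto
    then show False using assms(2) by simp
  qed
  then obtain p where p: "p \<in># M" "hd p = w \<or> last p = w"
    by (auto simp: path_ends_def)
  have "p \<noteq> []" "distinct p" using assms(1) p(1) by (auto simp: decomposes_def)
  then show ?thesis
    using p unfolding path_upto_rev_def
    by (metis distinct_rev hd_rev rev_is_Nil_conv rev_rev_ident)
qed

text \<open>
  The induction removes an edge \<open>xy\<close>, lowers \<open>d x\<close> and raises \<open>d y\<close> by one, and rotates the edge back
  in at \<open>x\<close>. Choosing \<open>y\<close> as the vertex with \<open>d y = 0\<close>, if it exists, makes \<open>x\<close> the only
  non-isolated vertex that may have no path end.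
\<close>

lemma exists_decomposition:
  fixes d :: "'a \<Rightarrow> nat"
  assumes "finite E" "\<And>e. e \<in> E \<Longrightarrow> card e = 2" "finite {v. d v \<noteq> 0}"
    and "\<And>v. even (d v + card {e \<in> E. v \<in> e})"
    and "\<And>u v. u \<in> \<Union>E \<Longrightarrow> v \<in> \<Union>E \<Longrightarrow> d u = 0 \<Longrightarrow> d v = 0 \<Longrightarrow> u = v"
  shows "\<exists>M. decomposes M (mset_set E) \<and> (\<forall>v. total_ends M v = d v)"
  using assms
proof (induction "card E" arbitrary: E d)
  case 0
  then have E: "E = {}" by simp
  obtain M where "decomposes M {#}" "\<And>v. total_ends M v = (if v \<in> {v. d v \<noteq> 0} then d v else 0)"
    using trivial_paths[OF "0.prems"(3), of d] "0.prems"(4) E by auto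
  then show ?case unfolding E by (intro exI[of _ M]) auto
next
  case (Suc n)
  obtain x y where xy: "{x, y} \<in> E" "x \<noteq> y" and y: "\<And>v. v \<in> \<Union>E \<Longrightarrow> d v = 0 \<Longrightarrow> v = y"
  proof (cases "\<exists>v\<in>\<Union>E. d v = 0")
    case True
    then obtain y e where ye: "e \<in> E" "y \<in> e" "d y = 0" by blast
    then obtain x where "e = {x, y}" "x \<noteq> y"
      using Suc.prems(2)[of e] by (metis card_2_iff doubleton_eq_iff insert_commute insertE singletonD)
    then show ?thesis using that ye Suc.prems(5) by blast
  next
    case False
    obtain e where "e \<in> E" using Suc.hyps(2) by fastforce
    then obtain x y where "e = {x, y}" "x \<noteq> y" by (metis Suc.prems(2) card_2_iff)
    then show ?thesis using that False \<open>e \<in> E\<close> by blast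
  qed
  have dx: "d x > 0" using y[of x] xy by auto
  define E0 where "E0 = E - {{x, y}}"
  define d0 where "d0 = d(x := d x - 1, y := d y + 1)"
  have "{e \<in> E. v \<in> e} = (if v = x \<or> v = y then insert {x, y} {e \<in> E0. v \<in> e} else {e \<in> E0. v \<in> e})" for v
    using xy by (auto simp: E0_def)
  then have deg: "card {e \<in> E. v \<in> e} = card {e \<in> E0. v \<in> e} + of_bool (v = x \<or> v = y)" for v
    using Suc.prems(1) by (simp add: E0_def)
  have "\<exists>M. decomposes M (mset_set E0) \<and> (\<forall>v. total_ends M v = d0 v)"
  proof (rule Suc.hyps(1))
    show "n = card E0" using Suc.hyps(2) Suc.prems(1) xy by (simp add: E0_def)
    show "finite E0" using Suc.prems(1) by (simp add: E0_def)
    show "card e = 2" if "e \<in> E0" for e using that Suc.prems(2) by (simp add: E0_def)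
    have "{v. d0 v \<noteq> 0} \<subseteq> insert y {v. d v \<noteq> 0}" using dx by (auto simp: d0_def split: if_splits)
    then show "finite {v. d0 v \<noteq> 0}" using Suc.prems(3) by (meson finite_insert finite_subset)
    show "even (d0 v + card {e \<in> E0. v \<in> e})" for v
      using Suc.prems(4)[of v] deg[of v] dx xy(2) by (auto simp: d0_def)
    have "u = x" if "u \<in> \<Union>E0" "d0 u = 0" for u
      using that y[of u] by (auto simp: d0_def E0_def split: if_splits)
    then show "u = v" if "u \<in> \<Union>E0" "v \<in> \<Union>E0" "d0 u = 0" "d0 v = 0" for u v
      using that by metis
  qed
  then obtain M where M: "decomposes M (mset_set E0)" "\<And>v. total_ends M v = d0 v" by blast
  have X: "add_mset {x, y} (mset_set E0) = mset_set E"
    using xy Suc.prems(1) by (simp add: E0_def mset_set.remove)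
  define U where "U = {w. {x, w} \<in> E}"
  have "finite (\<Union>E)" using Suc.prems(1,2) by (metis card.infinite finite_Union zero_neq_numeral)
  moreover have "U \<subseteq> \<Union>E" by (auto simp: U_def)
  ultimately have finU: "finite U" by (rule rev_finite_subset)
  have xU: "x \<notin> U" using Suc.prems(2)[of "{x, x}"] by (auto simp: U_def)
  have "has_free_end M x w \<or> (\<exists>z\<in>U - {y}. has_arm M x w z)" if w: "w \<in> U" for w
  proof -
    \<comment> \<open>The only neighbour of \<open>x\<close> that can have \<open>d w = 0\<close> is
      \<open>y\<close>, where \<open>d0\<close> is one larger.\<close>
    have "d0 w > 0" using y[of w] w xU by (auto simp: d0_def U_def)
    then obtain q where q: "q \<noteq> []" "distinct q" "hd q = w" "path_upto_rev M q"
      using exists_path_upto_rev[OF M(1)] M(2) by metis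
    show ?thesis
    proof (cases "x \<in> set q")
      case False
      then show ?thesis using q by (auto simp: has_free_end_def)
    next
      case True
      then obtain a b where ab: "q = a @ x # b" by (meson split_list)
      have a: "a \<noteq> []" using ab q(3) w xU by (cases a) auto
      \<comment> \<open>The edge by which \<open>q\<close> enters \<open>x\<close> belongs to
        \<open>E0\<close>, so it is not \<open>xy\<close> and \<open>last a\<close> differs from
        \<open>y\<close>.\<close>
      have "{x, last a} \<in># edge_mset q" using a by (simp add: ab edge_mset_append insert_commute)
      then have "{x, last a} \<in># (\<Sum>p\<in>#M. edge_mset p)"
        using q(4) edge_mset_rev[of q] unfolding path_upto_rev_def
        by (metis in_Union_mset_iff image_eqI set_image_mset)
      moreover have "(\<Sum>p\<in>#M. edge_mset p) = mset_set E0"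
        using M(1) by (simp add: decomposes_def)
      ultimately have "{x, last a} \<in># mset_set E0" by metis
      then have "{x, last a} \<in> E0" using Suc.prems(1) by (simp add: E0_def)
      then have "last a \<in> U - {y}" by (auto simp: U_def E0_def)
      moreover have "has_arm M x w (last a)"
        using a q(3,4) unfolding ab has_arm_def by (auto simp: hd_append)
      ultimately show ?thesis by blast
    qed
  qed
  moreover have "y \<in> U" using xy by (simp add: U_def)
  ultimately obtain M' where M': "decomposes M' (mset_set E)"
    "\<And>v. total_ends M' v + of_bool (v = y) = total_ends M v + of_bool (v = x)"
    using rotate_at[OF finU _ xU M(1) X] by blast
  have "total_ends M' v = d v" for v
    using M'(2)[of v] M(2)[of v] dx xy(2) by (auto simp: d0_def split: if_splits)
  with M' show ?case by blast
qed

section \<open>Directing paths with at most two ends at each vertex\<close>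

text \<open>
  If \<open>f i = f j\<close>, no further end lies at this vertex, so \<open>i\<close> and \<open>j\<close> can be merged
  into one segment from \<open>g j\<close> to \<open>g i\<close> and oriented together.
\<close>

lemma exists_orientation:
  fixes f g :: "'i \<Rightarrow> 'v"
  assumes "finite I" "\<And>v. card {i \<in> I. f i = v} + card {i \<in> I. g i = v} \<le> 2"
  shows "\<exists>f' g'. (\<forall>i\<in>I. f' i = f i \<and> g' i = g i \<or> f' i = g i \<and> g' i = f i) \<and> inj_on f' I \<and> inj_on g' I"
  using assms
proof (induction "card I" arbitrary: I f g)
  case 0
  then show ?case by auto
next
  case (Suc n)
  have merge: "\<exists>f' g'. (\<forall>i\<in>I. f' i = f i \<and> g' i = g i \<or> f' i = g i \<and> g' i = f i) \<and> inj_on f' I \<and> inj_on g' I"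
    if ij: "i \<in> I" "j \<in> I" "i \<noteq> j" "f i = f j"
      and fg: "\<And>v. card {i \<in> I. f i = v} + card {i \<in> I. g i = v} \<le> 2" for i j and f g :: "'i \<Rightarrow> 'v"
  proof -
    define a where "a = f i"
    define J where "J = I - {j}"
    define h where "h = f(i := g j)"
    have fin: "finite {k \<in> I. P k}" for P using Suc.prems(1) by simp
    have sub: "{i, j} \<subseteq> {k \<in> I. f k = a}" using ij by (auto simp: a_def)
    have "card {k \<in> I. f k = a} \<ge> 2"
      using card_mono[OF fin sub] ij(3) by simp
    \<comment> \<open>The segments \<open>i\<close> and \<open>j\<close> exhaust the bound of two at
      \<open>a\<close>, so no further end lies there.\<close>
    then have ca: "card {k \<in> I. f k = a} = 2" "card {k \<in> I. g k = a} = 0" using fg[of a] by auto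
    have "{i, j} = {k \<in> I. f k = a}"
      by (rule card_subset_eq[OF fin sub]) (use ca ij in simp)
    then have fa: "f k \<noteq> a" if "k \<in> I" "k \<noteq> i" "k \<noteq> j" for k using that by blast
    have ga: "g k \<noteq> a" if "k \<in> I" for k using ca(2) that fin[of "\<lambda>k. g k = a"] by auto
    have deg: "card {k \<in> J. h k = v} + card {k \<in> J. g k = v} \<le> 2" for v
    proof (cases "v = a")
      case True
      then have "{k \<in> J. h k = v} = {}" "{k \<in> J. g k = v} = {}"
        using fa ga ij by (auto simp: J_def h_def)
      then show ?thesis by (metis add_0 card.empty zero_le)
    next
      case False
      then have *: "{k \<in> J. h k = v} = (if g j = v then insert i {k \<in> I. f k = v} else {k \<in> I. f k = v})"
        "{k \<in> J. g k = v} = {k \<in> I. g k = v} - {j}" "i \<notin> {k \<in> I. f k = v}"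
        using ij by (auto simp: J_def h_def a_def)
      show ?thesis
      proof (cases "g j = v")
        case True
        then have j: "j \<in> {k \<in> I. g k = v}" using ij by simp
        then have "card {k \<in> I. g k = v} > 0" using fin[of "\<lambda>k. g k = v"] card_gt_0_iff by fastforce
        moreover have "card {k \<in> J. h k = v} = Suc (card {k \<in> I. f k = v})"
          using *(1,3) True fin by simp
        moreover have "card {k \<in> J. g k = v} = card {k \<in> I. g k = v} - 1"
          unfolding *(2) using j by (rule card_Diff_singleton)
        ultimately show ?thesis using fg[of v] by linarith
      next
        case False
        then have "{k \<in> I. g k = v} - {j} = {k \<in> I. g k = v}" by auto
        then show ?thesis using * False fg[of v] by simp
      qed
    qed
    have "n = card J" using Suc.hyps(2) Suc.prems(1) ij by (simp add: J_def)
    from Suc.hyps(1)[OF this _ deg] Suc.prems(1) obtain f0 g0 where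
      fg0: "\<And>k. k \<in> J \<Longrightarrow> f0 k = h k \<and> g0 k = g k \<or> f0 k = g k \<and> g0 k = h k"
      "inj_on f0 J" "inj_on g0 J" unfolding J_def by blast
    have iJ: "i \<in> J" and jJ: "j \<notin> J" and I: "I = insert j J" using ij by (auto simp: J_def)
    have fg0': "f0 k = f k \<and> g0 k = g k \<or> f0 k = g k \<and> g0 k = f k" if "k \<in> J" "k \<noteq> i" for k
      using fg0(1)[of k] that by (simp add: h_def)
    \<comment> \<open>Since \<open>a\<close> is no end of a segment in \<open>J\<close>, it is free
      to be both a start and a final vertex once the merged segment is split there.\<close>
    have na: "f0 k \<noteq> a" "g0 k \<noteq> a" if "k \<in> J" for k
      using fg0(1)[OF that] fa[of k] ga[of k] ga[of j] ij that
      by (auto simp: h_def J_def split: if_splits)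
    have "f0 i = g j \<and> g0 i = g i \<or> f0 i = g i \<and> g0 i = g j"
      using fg0(1)[OF iJ] by (simp add: h_def)
    then show ?thesis
    proof
      \<comment> \<open>The merged segment runs from \<open>g j\<close> to \<open>g i\<close>: split
        at \<open>a\<close>, \<open>j\<close> runs into \<open>a\<close> and \<open>i\<close> runs
        out of it. In the other case below these directions are reversed.\<close>
      assume i: "f0 i = g j \<and> g0 i = g i"
      have fj: "f0 k \<noteq> g j" if "k \<in> J" "k \<noteq> i" for k
        using fg0(2) that iJ i by (metis inj_onD)
      have "inj_on (f0(i := a, j := g j)) I"
        unfolding I using fg0(2) na fj fj[symmetric] jJ iJ ij(3) ga[OF ij(2)]
        by (auto simp: inj_on_def)
      moreover have "inj_on (g0(j := a)) I"
        unfolding I using fg0(3) na jJ by (auto simp: inj_on_def)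
      moreover have "\<forall>k\<in>I. (f0(i := a, j := g j)) k = f k \<and> (g0(j := a)) k = g k \<or>
          (f0(i := a, j := g j)) k = g k \<and> (g0(j := a)) k = f k"
        using fg0' i ij by (auto simp: I a_def)
      ultimately show ?thesis by blast
    next
      assume i: "f0 i = g i \<and> g0 i = g j"
      have gj: "g0 k \<noteq> g j" if "k \<in> J" "k \<noteq> i" for k
        using fg0(3) that iJ i by (metis inj_onD)
      have "inj_on (g0(i := a, j := g j)) I"
        unfolding I using fg0(3) na gj gj[symmetric] jJ iJ ij(3) ga[OF ij(2)]
        by (auto simp: inj_on_def)
      moreover have "inj_on (f0(j := a)) I"
        unfolding I using fg0(2) na jJ by (auto simp: inj_on_def)
      moreover have "\<forall>k\<in>I. (f0(j := a)) k = f k \<and> (g0(i := a, j := g j)) k = g k \<or>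
          (f0(j := a)) k = g k \<and> (g0(i := a, j := g j)) k = f k"
        using fg0' i ij by (auto simp: I a_def)
      ultimately show ?thesis by blast
    qed
  qed
  show ?case
  proof (cases "inj_on f I \<and> inj_on g I")
    case True
    then show ?thesis by blast
  next
    case False
    then consider i j where "i \<in> I" "j \<in> I" "i \<noteq> j" "f i = f j" | i j where "i \<in> I" "j \<in> I" "i \<noteq> j" "g i = g j"
      by (auto simp: inj_on_def)
    then show ?thesis
    proof cases
      case 1
      then show ?thesis using merge[of i j f g] Suc.prems(2) by blast
    next
      case 2
      \<comment> \<open>The condition and the claim are symmetric in \<open>f\<close> and
        \<open>g\<close>.\<close>
      then show ?thesis using merge[of i j g f] Suc.prems(2) by (simp add: add.commute) blast
    qed
  qed
qed

text \<open>The prescription \<open>d\<close> is one at odd and two at even vertices of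
  \<open>V\<close>. It is positive on \<open>V\<close>, so every vertex becomes a start or a final
  vertex, and at most two, so the paths can be directed by
  \<open>exists_orientation\<close>.\<close>

lemma directed_decomposition:
  assumes "finite V" "\<forall>e\<in>E. card e = 2" "\<Union>E \<subseteq> V"
  shows "\<exists>S Q. (\<forall>v\<in>S. Q v \<noteq> [] \<and> distinct (Q v) \<and> hd (Q v) = v) \<and> inj_on (\<lambda>v. last (Q v)) S \<and>
    S \<union> (\<lambda>v. last (Q v)) ` S = V \<and> (\<Sum>v\<in>S. edge_mset (Q v)) = mset_set E"
proof -
  have finE: "finite E" using assms(1,3) finite_UnionD finite_subset by blast
  define d where "d v = (if v \<notin> V then 0 else if odd (card {e \<in> E. v \<in> e}) then 1 else 2 :: nat)" for v
  have "card {e \<in> E. v \<in> e} = 0" if "v \<notin> V" for v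
  proof -
    have "{e \<in> E. v \<in> e} = {}" using that assms(3) by blast
    then show ?thesis by (metis card.empty)
  qed
  then have ev: "even (d v + card {e \<in> E. v \<in> e})" for v
    by (cases "v \<in> V") (simp_all add: d_def)
  have supp: "{v. d v \<noteq> 0} = V" by (auto simp: d_def)
  have nz: "d u \<noteq> 0" if "u \<in> \<Union>E" for u using assms(3) that by (auto simp: d_def)
  have "\<exists>M. decomposes M (mset_set E) \<and> (\<forall>v. total_ends M v = d v)"
  proof (rule exists_decomposition[OF finE bspec[OF assms(2)] _ ev])
    show "finite {v. d v \<noteq> 0}" using assms(1) by (simp only: supp)
    show "u = v" if "u \<in> \<Union>E" "d u = 0" for u v using nz that by metis
  qed
  then obtain M where M: "decomposes M (mset_set E)" "\<And>v. total_ends M v = d v" by blast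
  \<comment> \<open>Positions in a list turn the multiset into an indexed family, which keeps
    possible repetitions apart.\<close>
  obtain qs where qs: "mset qs = M" using ex_mset by blast
  define I where "I = {..<length qs}"
  have sumI: "(\<Sum>p\<in>#M. \<phi> p) = (\<Sum>i\<in>I. \<phi> (qs ! i))" for \<phi> :: "'a list \<Rightarrow> 'c::comm_monoid_add"
    unfolding qs[symmetric] I_def mset_map[symmetric] sum_mset_sum_list
    by (simp add: sum_list_sum_nth atLeast0LessThan)
  have ends: "card {i \<in> I. hd (qs ! i) = v} + card {i \<in> I. last (qs ! i) = v} = d v" for v
    using M(2)[of v] unfolding sumI by (simp add: path_ends_def sum.distrib I_def Int_def)
  have qsi: "qs ! i \<noteq> []" "distinct (qs ! i)" if "i \<in> I" for i
    using M(1) that unfolding decomposes_def qs[symmetric] I_def by auto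
  have "\<exists>f g. (\<forall>i\<in>I. f i = hd (qs ! i) \<and> g i = last (qs ! i) \<or> f i = last (qs ! i) \<and> g i = hd (qs ! i)) \<and>
      inj_on f I \<and> inj_on g I"
  proof (rule exists_orientation)
    show "finite I" by (simp add: I_def)
    show "card {i \<in> I. hd (qs ! i) = v} + card {i \<in> I. last (qs ! i) = v} \<le> 2" for v
      unfolding ends by (simp add: d_def)
  qed
  then obtain f g where fg: "\<And>i. i \<in> I \<Longrightarrow>
      f i = hd (qs ! i) \<and> g i = last (qs ! i) \<or> f i = last (qs ! i) \<and> g i = hd (qs ! i)"
    and inj: "inj_on f I" "inj_on g I" by blast
  define r where "r i = (if f i = hd (qs ! i) \<and> g i = last (qs ! i) then qs ! i else rev (qs ! i))" for i
  have r: "r i \<noteq> []" "distinct (r i)" "hd (r i) = f i" "last (r i) = g i" "edge_mset (r i) = edge_mset (qs ! i)"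
    if "i \<in> I" for i
    using fg[OF that] qsi[OF that] by (auto simp: r_def hd_rev last_rev)
  \<comment> \<open>The start vertices are distinct after orientation, so they can index the
    paths.\<close>
  define Q where "Q v = r (inv_into I f v)" for v
  have Qf: "Q (f i) = r i" if "i \<in> I" for i using that inj by (simp add: Q_def)
  have img: "(\<lambda>v. last (Q v)) ` f ` I = g ` I" using Qf r by (force simp: image_image)
  have "inj_on (\<lambda>v. last (Q v)) (f ` I)"
    using inj Qf r by (auto simp: inj_on_def)
  moreover have "f ` I \<union> g ` I = V"
  proof -
    have "v \<in> f ` I \<union> g ` I \<longleftrightarrow> d v > 0" for v
    proof -
      have "v \<in> f ` I \<union> g ` I \<longleftrightarrow> {i \<in> I. hd (qs ! i) = v} \<noteq> {} \<or> {i \<in> I. last (qs ! i) = v} \<noteq> {}"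
        using fg by (auto simp: image_iff) metis+
      also have "\<dots> \<longleftrightarrow> card {i \<in> I. hd (qs ! i) = v} > 0 \<or> card {i \<in> I. last (qs ! i) = v} > 0"
        by (simp add: card_gt_0_iff I_def)
      finally show ?thesis by (simp add: ends[symmetric])
    qed
    moreover have "d v > 0 \<longleftrightarrow> v \<in> V" for v by (simp add: d_def)
    ultimately show ?thesis by (intro set_eqI) simp
  qed
  moreover have "(\<Sum>v\<in>f ` I. edge_mset (Q v)) = mset_set E"
  proof -
    have "(\<Sum>v\<in>f ` I. edge_mset (Q v)) = (\<Sum>i\<in>I. edge_mset (qs ! i))"
      unfolding sum.reindex[OF inj(1)] using Qf r by (intro sum.cong) auto
    then show ?thesis using M(1) by (simp add: decomposes_def sumI)
  qed
  ultimately show ?thesis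
    using img Qf r by (intro exI[of _ "f ` I"] exI[of _ Q]) auto
qed

section \<open>Strands in the product along a path\<close>

lemma edge_mset_Pair: "edge_mset (map (Pair u) p) = image_mset (\<lambda>e. {u} \<times> e) (edge_mset p)"
  unfolding edge_mset_map by (intro image_mset_cong) auto

text \<open>
  \<open>W\<close> collects the finished paths and \<open>F v\<close> is the strand that currently ends in layer \<open>v\<close>.
\<close>

lemma prefix_system:
  fixes A :: "'u set" and V :: "'v set" and X :: "'v set multiset"
  assumes "finite V" "S \<subseteq> V" and hd: "\<forall>v\<in>S. Q v \<noteq> [] \<and> distinct (Q v) \<and> hd (Q v) = v"
    and \<sigma>: "bij_betw (\<lambda>v. last (Q v)) S T" "T \<subseteq> V"
    and X: "(\<Sum>v\<in>S. edge_mset (Q v)) = X"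
    and p: "p \<noteq> []" "distinct p" "hd p \<in> A"
  shows "\<exists>W F. (\<forall>q\<in>#W. q \<noteq> [] \<and> distinct q) \<and>
    (\<forall>v\<in>V. F v \<noteq> [] \<and> distinct (F v) \<and> last (F v) = (last p, v) \<and> fst ` set (F v) \<subseteq> set p) \<and>
    (\<Sum>q\<in>#W. edge_mset q) + (\<Sum>v\<in>V. edge_mset (F v)) =
      (\<Sum>v\<in>V. image_mset (\<lambda>e. e \<times> {v}) (edge_mset p)) + (\<Sum>u\<in>A \<inter> set p. image_mset (\<lambda>e. {u} \<times> e) X) \<and>
    size W = (card (A \<inter> set p) - 1) * card (V - S) \<and>
    (last p \<in> A \<longrightarrow> (\<forall>v\<in>V - T. edge_mset (F v) = {#}))"
  using p
proof (induction p rule: rev_induct)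
  case Nil
  then show ?case by simp
next
  case (snoc u p)
  note hd = bspec[OF hd]
  let ?\<sigma> = "\<lambda>v. last (Q v)"
  \<comment> \<open>For a layer \<open>w\<close> in \<open>T\<close>, \<open>\<tau> w\<close> is the
    layer from which a diverted strand arrives in \<open>w\<close>.\<close>
  define \<tau> where "\<tau> = inv_into S ?\<sigma>"
  have \<tau>: "bij_betw \<tau> T S" "\<And>w. w \<in> T \<Longrightarrow> last (Q (\<tau> w)) = w"
    unfolding \<tau>_def using bij_betw_inv_into[OF \<sigma>(1)] bij_betw_inv_into_right[OF \<sigma>(1)] by auto
  have finS: "finite S" "finite T" using assms by (auto intro: finite_subset)
  have \<tau>S: "\<tau> w \<in> S" if "w \<in> T" for w using \<tau>(1) that by (auto simp: bij_betw_def)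
  have colX: "(\<Sum>v\<in>S. edge_mset (map (Pair u) (Q v))) = image_mset (\<lambda>e. {u} \<times> e) X"
  proof -
    have "image_mset (\<lambda>e. {u} \<times> e) (\<Sum>v\<in>S. edge_mset (Q v)) = (\<Sum>v\<in>S. image_mset (\<lambda>e. {u} \<times> e) (edge_mset (Q v)))"
      using finS(1) by (induction S) auto
    then show ?thesis by (simp add: X edge_mset_Pair)
  qed
  have dQ: "distinct (map (Pair u) (Q v))" if "v \<in> S" for v
    using hd[OF that] by (simp add: distinct_map inj_on_def)
  show ?case
  proof (cases "p = []")
    case True
    \<comment> \<open>Over the first vertex, a strand in a layer of \<open>T\<close> begins with the
      copy of the path that ends in this layer; all others are trivial, and no strand is finished
      yet.\<close>
    define F where "F w = (if w \<in> T then map (Pair u) (Q (\<tau> w)) else [(u, w)])" for w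
    have "F w \<noteq> [] \<and> distinct (F w) \<and> last (F w) = (u, w) \<and> fst ` set (F w) \<subseteq> {u}" for w
      using \<tau>S[of w] \<tau>(2)[of w] hd[of "\<tau> w"] dQ[of "\<tau> w"] by (auto simp: F_def last_map)
    moreover have "(\<Sum>w\<in>V. edge_mset (F w)) = image_mset (\<lambda>e. {u} \<times> e) X"
    proof -
      have "(\<Sum>w\<in>V. edge_mset (F w)) = (\<Sum>w\<in>T. edge_mset (F w))"
        by (rule sum.mono_neutral_right) (use assms in \<open>auto simp: F_def\<close>)
      also have "\<dots> = (\<Sum>w\<in>T. edge_mset (map (Pair u) (Q (\<tau> w))))" by (simp add: F_def)
      also have "\<dots> = (\<Sum>v\<in>S. edge_mset (map (Pair u) (Q v)))"
        using \<tau>(1) by (rule sum.reindex_bij_betw)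
      finally show ?thesis by (simp only: colX)
    qed
    moreover have "\<forall>w\<in>V - T. edge_mset (F w) = {#}" by (simp add: F_def)
    moreover have "A \<inter> {u} = {u}" using snoc.prems True by auto
    ultimately show ?thesis using True by (intro exI[of _ "{#}"] exI[of _ F]) simp
  next
    case False
    then have pA: "distinct p" "hd p \<in> A" using snoc.prems by (auto simp: hd_append)
    obtain W F where WF: "\<And>q. q \<in># W \<Longrightarrow> q \<noteq> [] \<and> distinct q"
      "\<And>v. v \<in> V \<Longrightarrow> F v \<noteq> [] \<and> distinct (F v) \<and> last (F v) = (last p, v) \<and> fst ` set (F v) \<subseteq> set p"
      "(\<Sum>q\<in>#W. edge_mset q) + (\<Sum>v\<in>V. edge_mset (F v)) =
        (\<Sum>v\<in>V. image_mset (\<lambda>e. e \<times> {v}) (edge_mset p)) + (\<Sum>u\<in>A \<inter> set p. image_mset (\<lambda>e. {u} \<times> e) X)"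
      "size W = (card (A \<inter> set p) - 1) * card (V - S)"
      using snoc.IH[OF False pA]
      by (elim exE conjE) (rule that, erule (1) bspec, erule (1) bspec, assumption, assumption)
    have u: "u \<notin> set p" using snoc.prems by auto
    have hdA: "hd p \<in> A \<inter> set p" using snoc.prems False by auto
    then have cA: "card (A \<inter> set p) > 0" using card_gt_0_iff by blast
    \<comment> \<open>First let every strand follow the edge from \<open>last p\<close> to
      \<open>u\<close> within its own layer.\<close>
    define F1 where "F1 v = F v @ [(u, v)]" for v
    have disj: "(u, w) \<notin> set (F v)" if "v \<in> V" for v w
      using WF(2)[OF that] u by (metis fst_conv image_eqI subsetD)
    have F1: "F1 v \<noteq> [] \<and> distinct (F1 v) \<and> last (F1 v) = (u, v) \<and> fst ` set (F1 v) \<subseteq> insert u (set p)"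
      if "v \<in> V" for v
      using WF(2)[OF that] disj[OF that] by (force simp: F1_def)
    have emp: "edge_mset (p @ [u]) = edge_mset p + {#{last p, u}#}"
      using False by (simp add: edge_mset_append)
    have emF1: "edge_mset (F1 v) = edge_mset (F v) + {#{last p, u} \<times> {v}#}" if "v \<in> V" for v
    proof -
      have "{(last p, v), (u, v)} = {last p, u} \<times> {v}" by auto
      then show ?thesis using WF(2)[OF that] by (simp add: F1_def edge_mset_append)
    qed
    have sumF1: "(\<Sum>q\<in>#W. edge_mset q) + (\<Sum>v\<in>V. edge_mset (F1 v)) =
        (\<Sum>v\<in>V. image_mset (\<lambda>e. e \<times> {v}) (edge_mset (p @ [u]))) +
        (\<Sum>u\<in>A \<inter> set p. image_mset (\<lambda>e. {u} \<times> e) X)"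
    proof -
      have "(\<Sum>v\<in>V. edge_mset (F1 v)) = (\<Sum>v\<in>V. edge_mset (F v)) + (\<Sum>v\<in>V. {#{last p, u} \<times> {v}#})"
        unfolding sum.distrib[symmetric] by (rule sum.cong) (simp_all only: emF1)
      moreover have "(\<Sum>v\<in>V. image_mset (\<lambda>e. e \<times> {v}) (edge_mset (p @ [u]))) =
          (\<Sum>v\<in>V. image_mset (\<lambda>e. e \<times> {v}) (edge_mset p)) + (\<Sum>v\<in>V. {#{last p, u} \<times> {v}#})"
        unfolding emp sum.distrib[symmetric] by simp
      ultimately show ?thesis using WF(3) by (metis (no_types, lifting) add.assoc add.commute)
    qed
    show ?thesis
    proof (cases "u \<in> A")
      case False
      then have "A \<inter> set (p @ [u]) = A \<inter> set p" by auto
      then show ?thesis using WF(1,4) F1 sumF1 \<open>u \<notin> A\<close> by (intro exI[of _ W] exI[of _ F1]) simp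
    next
      case True
      \<comment> \<open>As \<open>Q v\<close> starts at \<open>v\<close>, the edge joining the two
        pieces is the one that \<open>F1 v\<close> adds; the diversion therefore contributes just
        the copy of \<open>Q v\<close> over \<open>u\<close>.\<close>
      define X1 where "X1 v = F v @ map (Pair u) (Q v)" for v
      have X1: "X1 v \<noteq> [] \<and> distinct (X1 v) \<and> last (X1 v) = (u, last (Q v)) \<and>
          fst ` set (X1 v) \<subseteq> insert u (set p)" if "v \<in> S" for v
      proof -
        have "v \<in> V" using that assms(2) by blast
        then show ?thesis
          using WF(2)[of v] disj[of v] \<open>v \<in> V\<close> hd[OF that] dQ[OF that] by (auto simp: X1_def last_map)
      qed
      have emX1: "edge_mset (X1 v) = edge_mset (F1 v) + edge_mset (map (Pair u) (Q v))" if "v \<in> S" for v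
      proof -
        have "v \<in> V" using that assms(2) by blast
        then show ?thesis
          using WF(2)[of v] hd[OF that] by (simp add: X1_def F1_def edge_mset_append hd_map)
      qed
      \<comment> \<open>Diverted strands continue in the layers of \<open>T\<close>, and trivial
        ones begin in the others. The strands \<open>F1 v\<close> in layers outside \<open>S\<close>
        are finished and join \<open>W'\<close>.\<close>
      define F' where "F' w = (if w \<in> T then X1 (\<tau> w) else [(u, w)])" for w
      define W' where "W' = W + image_mset F1 (mset_set (V - S))"
      have F': "F' w \<noteq> [] \<and> distinct (F' w) \<and> last (F' w) = (u, w) \<and> fst ` set (F' w) \<subseteq> insert u (set p)" for w
        using \<tau>S[of w] \<tau>(2)[of w] X1[of "\<tau> w"] by (simp add: F'_def)
      have W': "q \<noteq> [] \<and> distinct q" if "q \<in># W'" for q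
        using that WF(1) F1 assms(1) by (auto simp: W'_def)
      have "(\<Sum>w\<in>V. edge_mset (F' w)) = (\<Sum>w\<in>T. edge_mset (F' w))"
        by (rule sum.mono_neutral_right) (use assms in \<open>auto simp: F'_def\<close>)
      also have "\<dots> = (\<Sum>w\<in>T. edge_mset (X1 (\<tau> w)))" by (simp add: F'_def)
      also have "\<dots> = (\<Sum>v\<in>S. edge_mset (X1 v))"
        using \<tau>(1) by (rule sum.reindex_bij_betw)
      also have "\<dots> = (\<Sum>v\<in>S. edge_mset (F1 v)) + image_mset (\<lambda>e. {u} \<times> e) X"
        unfolding colX[symmetric] sum.distrib[symmetric] by (rule sum.cong) (simp_all only: emX1)
      finally have sF': "(\<Sum>w\<in>V. edge_mset (F' w)) = (\<Sum>v\<in>S. edge_mset (F1 v)) + image_mset (\<lambda>e. {u} \<times> e) X" .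
      have sW': "(\<Sum>q\<in>#W'. edge_mset q) = (\<Sum>q\<in>#W. edge_mset q) + (\<Sum>v\<in>V - S. edge_mset (F1 v))"
        by (simp add: W'_def image_mset.compositionality comp_def sum_unfold_sum_mset)
      have sV: "(\<Sum>v\<in>V. edge_mset (F1 v)) = (\<Sum>v\<in>V - S. edge_mset (F1 v)) + (\<Sum>v\<in>S. edge_mset (F1 v))"
        using assms(2,1) by (rule sum.subset_diff)
      have AI: "A \<inter> set (p @ [u]) = insert u (A \<inter> set p)" "u \<notin> A \<inter> set p" using True u by auto
      have sA: "(\<Sum>u\<in>A \<inter> set (p @ [u]). image_mset (\<lambda>e. {u} \<times> e) X) =
          image_mset (\<lambda>e. {u} \<times> e) X + (\<Sum>u\<in>A \<inter> set p. image_mset (\<lambda>e. {u} \<times> e) X)"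
        unfolding AI(1) using AI(2) by (simp del: Int_iff)
      have "(\<Sum>q\<in>#W'. edge_mset q) + (\<Sum>w\<in>V. edge_mset (F' w)) =
          ((\<Sum>q\<in>#W. edge_mset q) + (\<Sum>v\<in>V. edge_mset (F1 v))) + image_mset (\<lambda>e. {u} \<times> e) X"
        unfolding sF' sW' sV by (simp only: ac_simps)
      also have "\<dots> = (\<Sum>v\<in>V. image_mset (\<lambda>e. e \<times> {v}) (edge_mset (p @ [u]))) +
          (\<Sum>u\<in>A \<inter> set (p @ [u]). image_mset (\<lambda>e. {u} \<times> e) X)"
        unfolding sumF1 sA by (simp only: ac_simps)
      finally have "(\<Sum>q\<in>#W'. edge_mset q) + (\<Sum>w\<in>V. edge_mset (F' w)) =
          (\<Sum>v\<in>V. image_mset (\<lambda>e. e \<times> {v}) (edge_mset (p @ [u]))) +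
          (\<Sum>u\<in>A \<inter> set (p @ [u]). image_mset (\<lambda>e. {u} \<times> e) X)" .
      moreover have "\<forall>w\<in>V - T. edge_mset (F' w) = {#}" by (simp add: F'_def)
      moreover have "size W' = (card (A \<inter> set (p @ [u])) - 1) * card (V - S)"
      proof -
        have "card (A \<inter> set (p @ [u])) = Suc (card (A \<inter> set p))"
          unfolding AI(1) using AI(2) by (simp del: Int_iff)
        \<comment> \<open>The first vertex of \<open>p\<close> is in \<open>A\<close>, so the
          subtraction of one, due to no strand ending there, is never truncated.\<close>
        moreover obtain k where "card (A \<inter> set p) = Suc k" using cA gr0_implies_Suc by blast
        ultimately show ?thesis using WF(4) by (simp add: W'_def)
      qed
      ultimately show ?thesis using W' F' by (intro exI[of _ W'] exI[of _ F']) simp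
    qed
  qed
qed

text \<open>As \<open>p\<close> ends in \<open>A\<close>, the strands outside \<open>T\<close> have
  only just begun and carry no edge; dropping them leaves \<open>card S\<close> strands. With
  \<open>k + 2\<close> vertices in \<open>A \<inter> set p\<close>, the total is
  \<open>k * card (V - S) + card V\<close>, and \<open>V - S\<close> has at most half of the
  layers.\<close>

lemma path_layers:
  fixes A :: "'u set" and V :: "'v set" and X :: "'v set multiset"
  assumes V: "finite V" "S \<subseteq> V" and hd: "\<forall>v\<in>S. Q v \<noteq> [] \<and> distinct (Q v) \<and> hd (Q v) = v"
    and \<sigma>: "inj_on (\<lambda>v. last (Q v)) S" "S \<union> (\<lambda>v. last (Q v)) ` S = V"
    and X: "(\<Sum>v\<in>S. edge_mset (Q v)) = X"
    and p: "p \<noteq> []" "distinct p" "hd p \<in> A" "last p \<in> A" "hd p \<noteq> last p"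
  shows "\<exists>M. decomposes M ((\<Sum>v\<in>V. image_mset (\<lambda>e. e \<times> {v}) (edge_mset p)) +
      (\<Sum>u\<in>A \<inter> set p. image_mset (\<lambda>e. {u} \<times> e) X)) \<and> 2 * size M \<le> card (A \<inter> set p) * card V"
proof -
  define T where "T = (\<lambda>v. last (Q v)) ` S"
  have bij: "bij_betw (\<lambda>v. last (Q v)) S T" using \<sigma>(1) by (simp add: T_def bij_betw_def)
  have TV: "T \<subseteq> V" using \<sigma>(2) by (auto simp: T_def)
  obtain W F where WF: "\<And>q. q \<in># W \<Longrightarrow> q \<noteq> [] \<and> distinct q"
      "\<And>v. v \<in> V \<Longrightarrow> F v \<noteq> [] \<and> distinct (F v)"
      "(\<Sum>q\<in>#W. edge_mset q) + (\<Sum>v\<in>V. edge_mset (F v)) =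
        (\<Sum>v\<in>V. image_mset (\<lambda>e. e \<times> {v}) (edge_mset p)) + (\<Sum>u\<in>A \<inter> set p. image_mset (\<lambda>e. {u} \<times> e) X)"
      "size W = (card (A \<inter> set p) - 1) * card (V - S)"
      "\<And>v. v \<in> V - T \<Longrightarrow> edge_mset (F v) = {#}"
    using prefix_system[OF V hd bij TV X p(1-3)] p(4)
    by (elim exE conjE) (rule that, erule (1) bspec, drule (1) bspec, blast, assumption, assumption,
      drule (1) mp, erule (1) bspec)
  define M where "M = W + image_mset F (mset_set T)"
  have finT: "finite T" "finite S" using TV V finite_subset by blast+
  have "(\<Sum>v\<in>V. edge_mset (F v)) = (\<Sum>v\<in>T. edge_mset (F v))"
    using V(1) TV WF(5) by (intro sum.mono_neutral_right) auto
  then have "(\<Sum>q\<in>#M. edge_mset q) = (\<Sum>q\<in>#W. edge_mset q) + (\<Sum>v\<in>V. edge_mset (F v))"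
    by (simp add: M_def image_mset.compositionality comp_def sum_unfold_sum_mset)
  moreover have "q \<noteq> [] \<and> distinct q" if "q \<in># M" for q
    using that WF(1,2) TV finT by (auto simp: M_def)
  ultimately have "decomposes M ((\<Sum>v\<in>V. image_mset (\<lambda>e. e \<times> {v}) (edge_mset p)) +
      (\<Sum>u\<in>A \<inter> set p. image_mset (\<lambda>e. {u} \<times> e) X))"
    unfolding decomposes_def WF(3)[symmetric] by blast
  moreover have "2 * size M \<le> card (A \<inter> set p) * card V"
  proof -
    \<comment> \<open>The two distinct ends of \<open>p\<close> are assigned to it; \<open>k\<close>
      counts its other assigned vertices.\<close>
    have "card {hd p, last p} \<le> card (A \<inter> set p)" using p by (intro card_mono) auto
    then obtain k where k: "card (A \<inter> set p) = k + 2"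
      using p(5) by (metis add.commute card_2_iff le_Suc_ex)
    have cT: "card T = card S" using bij by (simp add: bij_betw_same_card)
    have "card V \<le> 2 * card S" using card_Un_le[of S T] cT \<sigma>(2) by (simp add: T_def)
    moreover have cV: "card V = card (V - S) + card S"
      using V finT by (simp add: card_Diff_subset card_mono)
    ultimately have "2 * card (V - S) \<le> card V" by simp
    then have "k * (2 * card (V - S)) \<le> k * card V" by (rule mult_le_mono2)
    moreover have "size M = (k + 1) * card (V - S) + card S"
      by (simp add: M_def WF(4) k cT)
    ultimately show ?thesis unfolding k using cV by (simp add: algebra_simps)
  qed
  ultimately show ?thesis by blast
qed

section \<open>Parity of degrees and path ends\<close>

text \<open>At a vertex on the path, incident edges and ends add up to two, also for a trivial path;
  elsewhere both numbers vanish.\<close>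

lemma even_size_plus_ends:
  assumes "p \<noteq> []" "distinct p"
  shows "even (size (filter_mset ((\<in>) v) (edge_mset p)) + path_ends p v)"
  using assms
proof (induction p rule: edge_mset.induct)
  case (1 x y p)
  then have "x \<noteq> y" by auto
  with 1 show ?case by (auto simp: path_ends_def)
qed (auto simp: path_ends_def)

lemma even_degree_plus_ends:
  assumes "finite E" "decomposes M (mset_set E)"
  shows "even (card {e \<in> E. v \<in> e} + total_ends M v)"
proof -
  have "\<forall>p\<in>#M. p \<noteq> [] \<and> distinct p" using assms by (simp add: decomposes_def)
  then have "even (size (filter_mset ((\<in>) v) (\<Sum>p\<in>#M. edge_mset p)) + total_ends M v)"
  proof (induction M)
    case (add p M)
    then show ?case using even_size_plus_ends[of p v] by auto
  qed simp
  moreover have "(\<Sum>p\<in>#M. edge_mset p) = mset_set E" using assms by (simp add: decomposes_def)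
  ultimately show ?thesis using assms(1) by (simp add: filter_mset_mset_set)
qed

section \<open>Decompositions of graphs\<close>

lemma mset_set_UN:
  assumes "finite I" "\<And>i. i \<in> I \<Longrightarrow> finite (B i)"
    and "\<And>i j. i \<in> I \<Longrightarrow> j \<in> I \<Longrightarrow> i \<noteq> j \<Longrightarrow> B i \<inter> B j = {}"
  shows "(\<Sum>i\<in>I. mset_set (B i)) = mset_set (\<Union>i\<in>I. B i)"
  using assms
proof (induction I)
  case (insert i I)
  then have "B i \<inter> (\<Union>j\<in>I. B j) = {}" by blast
  then have "mset_set (B i \<union> (\<Union>j\<in>I. B j)) = mset_set (B i) + mset_set (\<Union>j\<in>I. B j)"
    using insert.hyps insert.prems(1) by (intro mset_set_Union) auto
  then show ?case using insert by simp
qed simp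

lemma edges_of_simps:
  assumes "pair_graph G"
  shows "finite (edges_of G)" "e \<in> edges_of G \<Longrightarrow> card e = 2" "\<Union>(edges_of G) \<subseteq> pverts G"
    "{u, v} \<in> edges_of G \<longleftrightarrow> (u, v) \<in> parcs G"
proof -
  interpret pair_graph G by fact
  have "edges_of G = (\<lambda>(u, v). {u, v}) ` parcs G" by (auto simp: edges_of_def)
  then show "finite (edges_of G)" by simp
  show "card e = 2" if e: "e \<in> edges_of G"
  proof -
    obtain u v where "e = {u, v}" "(u, v) \<in> parcs G" using e by (auto simp: edges_of_def)
    then show ?thesis using pair_no_loops[of "(u, v)"] by simp
  qed
  show "\<Union>(edges_of G) \<subseteq> pverts G"
    using wellformed' by (auto simp: edges_of_def)
  show "{u, v} \<in> edges_of G \<longleftrightarrow> (u, v) \<in> parcs G"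
    using sym_arcs by (auto simp: edges_of_def doubleton_eq_iff symmetric_def sym_def)
qed

lemma out_degree_eq_card_edges:
  assumes "pair_graph G"
  shows "out_degree (with_proj G) v = card {e \<in> edges_of G. v \<in> e}"
proof -
  interpret pair_graph G by fact
  have "bij_betw (\<lambda>a. {fst a, snd a}) (out_arcs (with_proj G) v) {e \<in> edges_of G. v \<in> e}"
  proof (rule bij_betwI')
    fix a b assume "a \<in> out_arcs (with_proj G) v" "b \<in> out_arcs (with_proj G) v"
    then show "({fst a, snd a} = {fst b, snd b}) = (a = b)"
      by (cases a; cases b) (auto simp: doubleton_eq_iff)
  next
    fix a assume "a \<in> out_arcs (with_proj G) v"
    then show "{fst a, snd a} \<in> {e \<in> edges_of G. v \<in> e}"
      by (cases a) (auto simp: edges_of_simps(4)[OF assms])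
  next
    fix e assume e: "e \<in> {e \<in> edges_of G. v \<in> e}"
    then have "card e = 2" using edges_of_simps(2)[OF assms] by blast
    with e obtain w where "e = {v, w}" by (auto simp: card_2_iff)
    with e show "\<exists>a\<in>out_arcs (with_proj G) v. e = {fst a, snd a}"
      by (intro bexI[of _ "(v, w)"]) (auto simp: edges_of_simps(4)[OF assms])
  qed
  then show ?thesis unfolding out_degree_def by (rule bij_betw_same_card)
qed

lemma set_subset_Union_edge_mset: "edge_mset p \<noteq> {#} \<Longrightarrow> set p \<subseteq> \<Union>(set_mset (edge_mset p))"
proof (induction p rule: edge_mset.induct)
  case (1 x y p)
  then show ?case by (cases p) auto
qed auto

text \<open>Edge-free members of \<open>M\<close> are discarded, since \<open>decomposes\<close>
  does not confine them to the graph. The others have all their vertices on edges of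
  \<open>K\<close>, and a shared edge would have multiplicity two in a set.\<close>

lemma path_number_le_size:
  assumes "pair_graph K" "decomposes M (mset_set (edges_of K))"
  shows "path_number K \<le> size M"
proof -
  define P where "P = {p \<in> set_mset M. edge_mset p \<noteq> {#}}"
  have M: "\<And>p. p \<in># M \<Longrightarrow> p \<noteq> [] \<and> distinct p" "(\<Sum>p\<in>#M. edge_mset p) = mset_set (edges_of K)"
    using assms(2) by (auto simp: decomposes_def)
  note E = edges_of_simps[OF assms(1)]
  have sub: "set_mset (edge_mset p) \<subseteq> edges_of K" if "p \<in># M" for p
  proof -
    have "edge_mset p \<subseteq># (\<Sum>p\<in>#M. edge_mset p)" using that
      by (metis mset_add image_mset_add_mset sum_mset.add_mset mset_subset_eq_add_left)
    then show ?thesis using M(2) E(1) by (metis finite_set_mset_mset_set set_mset_mono)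
  qed
  have "path_decomposition K P"
    unfolding path_decomposition_def
  proof (intro conjI ballI impI)
    show "finite P" by (simp add: P_def)
  next
    fix p assume p: "p \<in> P"
    then have pM: "p \<in># M" "edge_mset p \<noteq> {#}" by (auto simp: P_def)
    have "set p \<subseteq> pverts K"
      using set_subset_Union_edge_mset[OF pM(2)] sub[OF pM(1)] E(3) by blast
    moreover have "(u, v) \<in> parcs K" if "(u, v) \<in> set (vwalk_arcs p)" for u v
    proof -
      have "{u, v} \<in> path_edges p" using that by (auto simp: path_edges_def)
      then show ?thesis using sub[OF pM(1)] by (auto simp: set_edge_mset E(4)[symmetric])
    qed
    ultimately show "vpath p (with_proj K)"
      using M(1)[OF pM(1)] unfolding vpath_def vwalk_def by auto
  next
    fix p q assume pq: "p \<in> P" "q \<in> P" "p \<noteq> q"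
    then obtain M0 where M0: "M = add_mset p (add_mset q M0)"
      unfolding P_def by (metis (mono_tags, lifting) insert_noteq_member mem_Collect_eq mset_add)
    show "path_edges p \<inter> path_edges q = {}"
    proof (rule ccontr)
      assume "path_edges p \<inter> path_edges q \<noteq> {}"
      then obtain e where "e \<in># edge_mset p" "e \<in># edge_mset q" by (auto simp: set_edge_mset)
      then have "count (edge_mset p) e \<ge> 1" "count (edge_mset q) e \<ge> 1" by auto
      moreover have "count (\<Sum>p\<in>#M. edge_mset p) e \<ge> count (edge_mset p) e + count (edge_mset q) e"
        unfolding M0 by simp
      ultimately have "count (\<Sum>p\<in>#M. edge_mset p) e \<ge> 2" by linarith
      then show False unfolding M(2) by (simp add: count_mset_set' split: if_splits)
    qed
  next
    have "(\<Union>p\<in>P. path_edges p) = (\<Union>p\<in>set_mset M. set_mset (edge_mset p))"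
      unfolding P_def set_edge_mset[symmetric] by auto
    also have "\<dots> = set_mset (\<Sum>p\<in>#M. edge_mset p)" by auto
    finally show "(\<Union>p\<in>P. path_edges p) = edges_of K" using E(1) unfolding M(2) by simp
  qed
  then have "path_number K \<le> card P" unfolding path_number_def by (intro Least_le) blast
  also have "\<dots> \<le> card (set_mset M)" by (intro card_mono) (auto simp: P_def)
  also have "\<dots> \<le> size M" by (induction M) (auto simp: card_insert_if)
  finally show ?thesis .
qed

text \<open>By parity an optimal decomposition has at least one end at every odd vertex. It has
  \<open>2 * path_number G\<close> ends in total, which equals the number of odd vertices, so all
  these inequalities are equalities.\<close>

lemma tight_path_decomposition:
  assumes "pair_graph G" "2 * path_number G = n_odd G"
  obtains P where "finite P" "\<And>p. p \<in> P \<Longrightarrow> p \<noteq> [] \<and> distinct p \<and> set p \<subseteq> pverts G"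
    "(\<Sum>p\<in>P. edge_mset p) = mset_set (edges_of G)"
    "\<And>v. v \<in> pverts G \<Longrightarrow> (\<Sum>p\<in>P. path_ends p v) = of_bool (odd (card {e \<in> edges_of G. v \<in> e}))"
proof -
  interpret pair_graph G by fact
  note E = edges_of_simps[OF assms(1)]
  have "\<exists>P. path_decomposition G P \<and> card P = path_number G"
    unfolding path_number_def by (rule LeastI_ex) (use path_decomposition_exists[OF assms(1)] in blast)
  then obtain P where P: "path_decomposition G P" "card P = path_number G" by blast
  have fin: "finite P" using P(1) by (simp add: path_decomposition_def)
  have p: "p \<noteq> [] \<and> distinct p \<and> set p \<subseteq> pverts G" if "p \<in> P" for p
    using P(1) that by (auto simp: path_decomposition_def vpath_def vwalk_def)
  have "(\<Sum>p\<in>P. edge_mset p) = (\<Sum>p\<in>P. mset_set (path_edges p))"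
    using p edge_mset_distinct by (intro sum.cong) auto
  also have "\<dots> = mset_set (\<Union>p\<in>P. path_edges p)"
    using P(1) by (intro mset_set_UN fin) (auto simp: path_decomposition_def set_edge_mset[symmetric])
  finally have sum: "(\<Sum>p\<in>P. edge_mset p) = mset_set (edges_of G)"
    using P(1) by (simp add: path_decomposition_def)
  then have "decomposes (mset_set P) (mset_set (edges_of G))"
    using p fin by (simp add: decomposes_def sum_unfold_sum_mset)
  then have parity: "even (card {e \<in> edges_of G. v \<in> e} + (\<Sum>p\<in>P. path_ends p v))" for v
    using even_degree_plus_ends[OF E(1)] by (simp add: sum_unfold_sum_mset)
  let ?odd = "\<lambda>v. of_bool (odd (card {e \<in> edges_of G. v \<in> e})) :: nat"
  have "(\<Sum>v\<in>pverts G. \<Sum>p\<in>P. path_ends p v) = (\<Sum>p\<in>P. \<Sum>v\<in>pverts G. path_ends p v)"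
    by (rule sum.swap)
  also have "\<dots> = (\<Sum>p\<in>P. 2)"
  proof (rule sum.cong)
    fix q assume "q \<in> P"
    then have "hd q \<in> pverts G" "last q \<in> pverts G" using p[of q] by auto
    then have "pverts G \<inter> {v. hd q = v} = {hd q}" "pverts G \<inter> {v. last q = v} = {last q}" by auto
    then show "(\<Sum>v\<in>pverts G. path_ends q v) = 2" by (simp add: path_ends_def sum.distrib)
  qed simp
  also have "\<dots> = n_odd G" using P(2) assms(2) by simp
  also have "\<dots> = (\<Sum>v\<in>pverts G. ?odd v)"
    by (simp add: n_odd_def out_degree_eq_card_edges[OF assms(1)] Int_def)
  finally have "(\<Sum>v\<in>pverts G. ?odd v) = (\<Sum>v\<in>pverts G. \<Sum>p\<in>P. path_ends p v)" by simp
  then have "?odd v = (\<Sum>p\<in>P. path_ends p v)" if "v \<in> pverts G" for v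
  proof (rule sum_mono_inv)
    show "?odd v \<le> (\<Sum>p\<in>P. path_ends p v)" for v
      using parity[of v] by (cases "odd (card {e \<in> edges_of G. v \<in> e})") (auto simp: Suc_le_eq intro: odd_pos)
  qed (use that in auto)
  then show ?thesis using that[of P] fin p sum by simp
qed

section \<open>Edges of the Cartesian product\<close>

lemma mset_edges_cart_prod:
  assumes "pair_graph G" "pair_graph H"
  shows "mset_set (edges_of (cart_prod G H)) =
    (\<Sum>v\<in>pverts H. image_mset (\<lambda>e. e \<times> {v}) (mset_set (edges_of G))) +
    (\<Sum>u\<in>pverts G. image_mset (\<lambda>e. {u} \<times> e) (mset_set (edges_of H)))"
proof -
  interpret G: pair_graph G by fact
  interpret H: pair_graph H by fact
  note EG = edges_of_simps[OF assms(1)] and EH = edges_of_simps[OF assms(2)]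
  let ?A = "\<lambda>v. (\<lambda>e. e \<times> {v}) ` edges_of G" and ?B = "\<lambda>u. (\<lambda>e. {u} \<times> e) ` edges_of H"
  have neG: "e \<noteq> {}" if "e \<in> edges_of G" for e using EG(2)[OF that] by auto
  have neH: "e \<noteq> {}" if "e \<in> edges_of H" for e using EH(2)[OF that] by auto
  have A: "image_mset (\<lambda>e. e \<times> {v}) (mset_set (edges_of G)) = mset_set (?A v)" for v :: 'b
    by (rule image_mset_mset_set) (auto simp: inj_on_def times_eq_iff)
  have B: "image_mset (\<lambda>e. {u} \<times> e) (mset_set (edges_of H)) = mset_set (?B u)" for u :: 'a
    by (rule image_mset_mset_set) (auto simp: inj_on_def times_eq_iff)
  have UA: "(\<Sum>v\<in>pverts H. mset_set (?A v)) = mset_set (\<Union>v\<in>pverts H. ?A v)"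
    using EG(1) neG by (intro mset_set_UN) (auto simp: times_eq_iff)
  have UB: "(\<Sum>u\<in>pverts G. mset_set (?B u)) = mset_set (\<Union>u\<in>pverts G. ?B u)"
    using EH(1) neH by (intro mset_set_UN) (auto simp: times_eq_iff)
  have eq: "edges_of (cart_prod G H) = (\<Union>v\<in>pverts H. ?A v) \<union> (\<Union>u\<in>pverts G. ?B u)"
  proof (intro set_eqI iffI)
    fix e assume "e \<in> edges_of (cart_prod G H)"
    then obtain u1 v1 u2 v2 where e: "e = {(u1, v1), (u2, v2)}" "u1 \<in> pverts G" "v1 \<in> pverts H"
      "(u1, u2) \<in> parcs G \<and> v1 = v2 \<or> (v1, v2) \<in> parcs H \<and> u1 = u2"
      by (auto simp: edges_of_def cart_prod_def)
    from e(4) show "e \<in> (\<Union>v\<in>pverts H. ?A v) \<union> (\<Union>u\<in>pverts G. ?B u)"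
    proof
      assume "(u1, u2) \<in> parcs G \<and> v1 = v2"
      then have "e = {u1, u2} \<times> {v1}" "{u1, u2} \<in> edges_of G" using e(1) EG(4) by auto
      then show ?thesis using e(3) by blast
    next
      assume "(v1, v2) \<in> parcs H \<and> u1 = u2"
      then have "e = {u1} \<times> {v1, v2}" "{v1, v2} \<in> edges_of H" using e(1) EH(4) by auto
      then show ?thesis using e(2) by blast
    qed
  next
    fix e assume "e \<in> (\<Union>v\<in>pverts H. ?A v) \<union> (\<Union>u\<in>pverts G. ?B u)"
    then show "e \<in> edges_of (cart_prod G H)"
    proof
      assume "e \<in> (\<Union>v\<in>pverts H. ?A v)"
      then obtain v u1 u2 where *: "v \<in> pverts H" "(u1, u2) \<in> parcs G" "e = {u1, u2} \<times> {v}"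
        by (auto simp: edges_of_def)
      then have "e = {(u1, v), (u2, v)}" "((u1, v), (u2, v)) \<in> parcs (cart_prod G H)"
        using G.wellformed'[OF *(2)] by (auto simp: cart_prod_def)
      then show ?thesis unfolding edges_of_def by blast
    next
      assume "e \<in> (\<Union>u\<in>pverts G. ?B u)"
      then obtain u v1 v2 where *: "u \<in> pverts G" "(v1, v2) \<in> parcs H" "e = {u} \<times> {v1, v2}"
        by (auto simp: edges_of_def)
      then have "e = {(u, v1), (u, v2)}" "((u, v1), (u, v2)) \<in> parcs (cart_prod G H)"
        using H.wellformed'[OF *(2)] by (auto simp: cart_prod_def)
      then show ?thesis unfolding edges_of_def by blast
    qed
  qed
  have "(\<Union>v\<in>pverts H. ?A v) \<inter> (\<Union>u\<in>pverts G. ?B u) = {}"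
  proof -
    \<comment> \<open>An edge of both kinds would project to a single vertex of \<open>G\<close>,
      but \<open>e\<close> has two.\<close>
    have "e \<times> {v} \<noteq> {u} \<times> e'" if "e \<in> edges_of G" for e e' u and v :: 'b
    proof
      assume "e \<times> {v} = {u} \<times> e'"
      then have "e = {} \<or> e = {u}" by (auto simp: times_eq_iff)
      then show False using EG(2)[OF that] by auto
    qed
    then show ?thesis by blast
  qed
  then have "mset_set ((\<Union>v\<in>pverts H. ?A v) \<union> (\<Union>u\<in>pverts G. ?B u)) =
      mset_set (\<Union>v\<in>pverts H. ?A v) + mset_set (\<Union>u\<in>pverts G. ?B u)"
    using EG(1) EH(1) by (intro mset_set_Union) auto
  then show ?thesis unfolding eq A B UA UB .
qed

text \<open>The first arc of a walk to a second vertex gives the edge. This guarantees that every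
  vertex of \<open>G\<close> lies on some path of a decomposition and can be assigned.\<close>

lemma connected_imp_not_isolated:
  assumes "pair_graph G" "connected (with_proj G)" "card (pverts G) \<ge> 2" "u \<in> pverts G"
  shows "\<exists>e\<in>edges_of G. u \<in> e"
proof -
  interpret pair_graph G by fact
  have "pverts G \<noteq> {u}" using assms(3) by auto
  then obtain w where w: "w \<in> pverts G" "w \<noteq> u" using assms(4) by blast
  have "strongly_connected (with_proj G)"
    using symmetric_connected_imp_strongly_connected sym_arcs assms(2) by blast
  then have "u \<rightarrow>\<^sup>*\<^bsub>with_proj G\<^esub> w"
    using assms(4) w(1) by (auto simp: strongly_connected_def)
  then obtain x where "u \<rightarrow>\<^bsub>with_proj G\<^esub> x"
    using w(2) by (cases rule: converse_reachable_cases) auto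
  then have "{u, x} \<in> edges_of G" by (auto simp: edges_of_def)
  then show ?thesis by blast
qed

section \<open>Assigning vertices to paths and adding up the bounds\<close>

theorem theorem4p2:
  fixes G :: "'a pair_pre_digraph" and H :: "'b pair_pre_digraph" and m n :: nat
  assumes "pair_graph G" and "connected (with_proj G)" and "card (pverts G) = m" and "m \<ge> 2"
    and "pair_graph H" and "connected (with_proj H)" and "card (pverts H) = n"
    and "real (path_number G) = real (n_odd G) / 2"
  shows "real (path_number (cart_prod G H)) \<le> real (m * n) / 2"
proof -
  interpret G: pair_graph G by fact
  interpret H: pair_graph H by fact
  note EG = edges_of_simps[OF assms(1)] and EH = edges_of_simps[OF assms(5)]
  have tight: "2 * path_number G = n_odd G" using assms(8) by linarith
  obtain P where finP: "finite P"
    and P: "\<And>p. p \<in> P \<Longrightarrow> p \<noteq> [] \<and> distinct p \<and> set p \<subseteq> pverts G"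
    and sumP: "(\<Sum>p\<in>P. edge_mset p) = mset_set (edges_of G)"
    and ends: "\<And>v. v \<in> pverts G \<Longrightarrow>
      (\<Sum>p\<in>P. path_ends p v) = of_bool (odd (card {e \<in> edges_of G. v \<in> e}))"
    using tight_path_decomposition[OF assms(1) tight] by blast
  have ends_le: "(\<Sum>p\<in>P. path_ends p v) \<le> 1" if "v \<in> pverts G" for v
    using ends[OF that] by simp
  have end_unique: "p = q" if "p \<in> P" "q \<in> P" "v \<in> pverts G" "path_ends p v > 0" "path_ends q v > 0" for p q v
  proof (rule ccontr)
    assume "p \<noteq> q"
    then have "path_ends p v + path_ends q v = (\<Sum>p\<in>{p, q}. path_ends p v)" by simp
    also have "\<dots> \<le> (\<Sum>p\<in>P. path_ends p v)" using that finP by (intro sum_mono2) auto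
    finally show False using that ends_le[of v] by linarith
  qed
  have hd_neq_last: "hd p \<noteq> last p" if "p \<in> P" for p
  proof
    assume "hd p = last p"
    then have "path_ends p (hd p) = 2" by (simp add: path_ends_def)
    moreover have "path_ends p (hd p) \<le> (\<Sum>q\<in>P. path_ends q (hd p))"
      using that finP by (intro member_le_sum) auto
    moreover have "hd p \<in> pverts G" using P[OF that] by (meson hd_in_set subsetD)
    ultimately show False using ends_le[of "hd p"] by simp
  qed
  \<comment> \<open>Preferring a path that ends at \<open>u\<close> makes every path receive both of
    its ends, because by \<open>end_unique\<close> no other path competes for them.\<close>
  have "\<exists>p. p \<in> P \<and> u \<in> set p \<and> ((\<exists>q\<in>P. path_ends q u > 0) \<longrightarrow> path_ends p u > 0)"
    if u: "u \<in> pverts G" for u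
  proof (cases "\<exists>q\<in>P. path_ends q u > 0")
    case True
    then obtain q where "q \<in> P" "path_ends q u > 0" by blast
    moreover from this have "u \<in> set q"
      using P[of q] by (auto simp: path_ends_def split: if_splits)
    ultimately show ?thesis by blast
  next
    case False
    obtain e where "e \<in> edges_of G" "u \<in> e"
      using connected_imp_not_isolated[OF assms(1,2) _ u] assms(3,4) by blast
    then have "e \<in># (\<Sum>p\<in>P. edge_mset p)" using EG(1) unfolding sumP by simp
    then obtain p where "p \<in> P" "e \<in># edge_mset p" using finP by (auto simp: sum_unfold_sum_mset)
    then show ?thesis using False edge_mset_subset \<open>u \<in> e\<close> by blast
  qed
  then obtain \<alpha> where \<alpha>: "\<And>u. u \<in> pverts G \<Longrightarrow> \<alpha> u \<in> P \<and> u \<in> set (\<alpha> u) \<and>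
      ((\<exists>q\<in>P. path_ends q u > 0) \<longrightarrow> path_ends (\<alpha> u) u > 0)" by metis
  define A where "A p = {u \<in> pverts G. \<alpha> u = p}" for p
  have end_in_A: "u \<in> A p" if "p \<in> P" "u = hd p \<or> u = last p" for p u
  proof -
    have "path_ends p u > 0" using that(2) by (auto simp: path_ends_def)
    moreover have u: "u \<in> pverts G" using P[OF that(1)] that(2) by auto
    ultimately have "\<alpha> u = p" using \<alpha>[OF u] that(1) end_unique by blast
    with u show ?thesis by (simp add: A_def)
  qed
  have A_sub: "A p \<inter> set p = A p" for p using \<alpha> by (auto simp: A_def)
  have "\<forall>e\<in>edges_of H. card e = 2" using EH(2) by blast
  from directed_decomposition[OF H.pair_finite_verts this EH(3)] obtain S Q where SQ: "\<forall>v\<in>S. Q v \<noteq> [] \<and> distinct (Q v) \<and> hd (Q v) = v"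
    "inj_on (\<lambda>v. last (Q v)) S" "S \<union> (\<lambda>v. last (Q v)) ` S = pverts H"
    "(\<Sum>v\<in>S. edge_mset (Q v)) = mset_set (edges_of H)"
    by (elim exE conjE) (rule that)
  have SV: "S \<subseteq> pverts H" using SQ(3) by blast
  \<comment> \<open>The share of \<open>p\<close> in the product: its copies in all layers and the
    copies of \<open>H\<close> over its assigned vertices. Each vertex is assigned once, so the
    shares partition the edges.\<close>
  define layer where "layer p = (\<Sum>v\<in>pverts H. image_mset (\<lambda>e. e \<times> {v}) (edge_mset p)) +
      (\<Sum>u\<in>A p. image_mset (\<lambda>e. {u} \<times> e) (mset_set (edges_of H)))" for p
  have "\<exists>M. decomposes M (layer p) \<and> 2 * size M \<le> card (A p) * n" if "p \<in> P" for p
  proof -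
    have p: "p \<noteq> []" "distinct p" "hd p \<in> A p" "last p \<in> A p" "hd p \<noteq> last p"
      using P[OF that] end_in_A[OF that] hd_neq_last[OF that] by auto
    show ?thesis
      using path_layers[OF H.pair_finite_verts SV SQ p] unfolding A_sub layer_def assms(7) .
  qed
  then obtain M where M: "\<And>p. p \<in> P \<Longrightarrow> decomposes (M p) (layer p) \<and> 2 * size (M p) \<le> card (A p) * n"
    by metis
  define N where "N = (\<Sum>p\<in>P. M p)"
  have partA: "(\<Sum>p\<in>P. \<Sum>u\<in>A p. \<phi> u) = (\<Sum>u\<in>pverts G. \<phi> u)" for \<phi> :: "'a \<Rightarrow> 'c::comm_monoid_add"
    unfolding A_def using \<alpha> finP by (intro sum.group) auto
  have "(\<Sum>q\<in>#N. edge_mset q) = (\<Sum>p\<in>P. layer p)"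
  proof -
    have "(\<Sum>q\<in>#(\<Sum>p\<in>P. M p). edge_mset q) = (\<Sum>p\<in>P. \<Sum>q\<in>#M p. edge_mset q)"
      using finP by (induction P) auto
    then show ?thesis using M by (simp add: N_def decomposes_def)
  qed
  also have "\<dots> = mset_set (edges_of (cart_prod G H))"
  proof -
    have "image_mset f (\<Sum>p\<in>P. edge_mset p) = (\<Sum>p\<in>P. image_mset f (edge_mset p))" for f :: "'a set \<Rightarrow> ('a \<times> 'b) set"
      using finP by (induction P) auto
    then have "(\<Sum>v\<in>pverts H. image_mset (\<lambda>e. e \<times> {v}) (mset_set (edges_of G))) =
        (\<Sum>v\<in>pverts H. \<Sum>p\<in>P. image_mset (\<lambda>e. e \<times> {v}) (edge_mset p))"
      by (simp only: sumP[symmetric])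
    also have "\<dots> = (\<Sum>p\<in>P. \<Sum>v\<in>pverts H. image_mset (\<lambda>e. e \<times> {v}) (edge_mset p))"
      by (rule sum.swap)
    finally show ?thesis
      unfolding layer_def sum.distrib partA mset_edges_cart_prod[OF assms(1,5)] by simp
  qed
  finally have "(\<Sum>q\<in>#N. edge_mset q) = mset_set (edges_of (cart_prod G H))" .
  moreover have "set_mset N = (\<Union>p\<in>P. set_mset (M p))"
    unfolding N_def using finP by (induction P) auto
  ultimately have "decomposes N (mset_set (edges_of (cart_prod G H)))"
    using M unfolding decomposes_def by blast
  then have "path_number (cart_prod G H) \<le> size N"
    using path_number_le_size pair_graph_cart_prod[OF assms(1,5)] by blast
  moreover have "2 * size N \<le> m * n"
  proof -
    have "2 * size N = (\<Sum>p\<in>P. 2 * size (M p))"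
      unfolding N_def using finP by (induction P) auto
    also have "\<dots> \<le> (\<Sum>p\<in>P. card (A p) * n)" using M by (intro sum_mono) blast
    also have "\<dots> = m * n"
      using partA[of "\<lambda>_. 1 :: nat"] assms(3) by (simp add: sum_distrib_right[symmetric])
    finally show ?thesis .
  qed
  ultimately have "real (2 * path_number (cart_prod G H)) \<le> real (m * n)" by linarith
  then show ?thesis by simp
qed

end
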